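(* Let $G$ be a graph in $\varepsilon_2$ with $p$ vertices and $q$ edges. Then $G$ is bipartite and $q\equiv 0$ or $2 \pmod 4$.
   Context: All graphs are finite, simple, undirected and connected. An Euler graph is a connected graph in which every vertex has even degree. $\varepsilon_2$ denotes the class of Euler graphs $G$ such that every cycle of $G$ has length $n\equiv 2 \pmod 4$. *)

theory Defs
  imports "HOL-Number_Theory.Cong" "Graph_Theory.Graph_Theory"
begin

text \<open>
  A finite simple undirected graph is an instance of the locale \<^locale>\<open>graph\<close>: a finite
  symmetric digraph without loops and parallel arcs. Each undirected edge is represented by
  a pair of opposite arcs, so undirected edges are counted as two-element vertex sets.
\<close>

definition edges :: "('a, 'b) pre_digraph \<Rightarrow> 'a set set" where
  "edges G = (\<lambda>e. {tail G e, head G e}) ` arcs G"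

text \<open>
  The arcs leaving a vertex of a \<^locale>\<open>graph\<close> correspond one to one to the edges incident
  with it, so \<^const>\<open>out_degree\<close> is the undirected degree. The one-vertex graph is an Euler
  graph; the null graph is not, since \<^const>\<open>connected\<close> excludes it.
\<close>

definition euler_graph :: "('a, 'b) pre_digraph \<Rightarrow> bool" where
  "euler_graph G \<longleftrightarrow> graph G \<and> connected G \<and> (\<forall>v \<in> verts G. even (out_degree G v))"

text \<open>
  \<^const>\<open>pre_digraph.cycle\<close> also holds for the closed walk along an arc and back along the
  opposite one; requiring at least three arcs leaves precisely the cycles of the undirected graph.
\<close>

definition undirected_cycle :: "('a, 'b) pre_digraph \<Rightarrow> 'b awalk \<Rightarrow> bool" where
  "undirected_cycle G c \<longleftrightarrow> pre_digraph.cycle G c \<and> 3 \<le> length c"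

definition epsilon2 :: "('a, 'b) pre_digraph set" where
  "epsilon2 = {G. euler_graph G \<and> (\<forall>c. undirected_cycle G c \<longrightarrow> [length c = 2] (mod 4))}"

text \<open>One of the parts may be empty, so that the one-vertex graph counts as bipartite.\<close>

definition bipartite :: "('a, 'b) pre_digraph \<Rightarrow> bool" where
  "bipartite G \<longleftrightarrow> (\<exists>U V. verts G = U \<union> V \<and> U \<inter> V = {} \<and>
     (\<forall>e \<in> arcs G. (tail G e \<in> U \<and> head G e \<in> V) \<or> (tail G e \<in> V \<and> head G e \<in> U)))"

end

theory Submission
  imports Defs
begin

text \<open>
  A shortest odd closed walk is a cycle, so in a graph of the class all closed walks are even,
  and the parity of the length of walks from a fixed vertex yields a bipartition. As each edge
  has exactly one end in a part \<open>U\<close>, the number of edges is the sum of the degrees over \<open>U\<close>,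
  all of which are even.
\<close>

text \<open>Strong induction on the length: a closed walk that is not a cycle splits at a repeated
  vertex into two shorter closed walks, and one of them is again odd.\<close>

lemma (in wf_digraph) odd_closed_awalk_imp_odd_cycle:
  assumes "awalk u p u" "odd (length p)"
  shows "\<exists>c. cycle c \<and> odd (length c)"
  using assms
proof (induction "length p" arbitrary: u p rule: less_induct)
  case less
  then obtain a p' where p: "p = a # p'"
    by (cases p) auto
  then have a: "a \<in> arcs G" "tail G a = u" and p': "awalk (head G a) p' u"
    using less.prems by (auto simp: awalk_Cons_iff)
  show ?case
  proof (cases "distinct (awalk_verts (head G a) p')")
    case True
    \<comment> \<open>\<open>cycle\<close> asks for distinctness only after dropping the first
      vertex, which recurs at the end; what remains is the vertex list of \<open>p'\<close>.\<close>
    then have "cycle p"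
      using less.prems p by (auto simp: cycle_def)
    then show ?thesis
      using less.prems by blast
  next
    case False
    obtain q r s w where qrs: "p' = q @ r @ s" "r \<noteq> []"
      and w: "awalk (head G a) q w" "awalk w r w" "awalk w s u"
      using awalk_not_distinct_decomp[OF p' False] by blast
    \<comment> \<open>The arc \<open>a\<close> stays outside \<open>r\<close>, and \<open>r\<close>
      is nonempty, so \<open>r\<close> and the rest are both shorter than \<open>p\<close>. Their
      lengths add up to that of \<open>p\<close>.\<close>
    have qs: "awalk u (a # q @ s) u"
      using a awalk_appendI[OF w(1,3)] by (simp add: awalk_Cons_iff)
    show ?thesis
    proof (cases "odd (length r)")
      case True
      show ?thesis
        by (rule less.hyps[OF _ w(2) True]) (simp add: p qrs)
    next
      case False
      show ?thesis
        by (rule less.hyps[OF _ qs]) (use less.prems False in \<open>auto simp: p qrs\<close>)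
    qed
  qed
qed

text \<open>Oddness rules out the back-and-forth cycle of two arcs, and a cycle of one arc would be
  a loop.\<close>

lemma (in loopfree_digraph) odd_closed_awalk_imp_odd_undirected_cycle:
  assumes "awalk u p u" "odd (length p)"
  shows "\<exists>c. undirected_cycle G c \<and> odd (length c)"
proof -
  obtain c where c: "cycle c" "odd (length c)"
    using odd_closed_awalk_imp_odd_cycle[OF assms] by blast
  have "length c \<noteq> 1"
  proof
    assume "length c = 1"
    then obtain a where "c = [a]"
      by (auto simp: length_Suc_conv)
    then show False
      using c(1) no_loops[of a] by (auto simp: cycle_def awalk_simps)
  qed
  with c(2) have "3 \<le> length c"
    by (auto elim!: oddE)
  with c show ?thesis
    by (auto simp: undirected_cycle_def)
qed

lemma (in sym_digraph) awalk_reverse: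
  assumes "awalk u p v"
  shows "\<exists>q. awalk v q u \<and> length q = length p"
  using assms
proof (induction p arbitrary: u)
  case Nil
  then show ?case
    by (auto simp: awalk_Nil_iff)
next
  case (Cons a p)
  then have a: "a \<in> arcs G" "tail G a = u" and "awalk (head G a) p v"
    by (auto simp: awalk_Cons_iff)
  with Cons.IH obtain q where q: "awalk v q (head G a)" "length q = length p"
    by blast
  obtain b where "b \<in> arcs G" "tail G b = head G a" "head G b = u"
    using a sym_arcs unfolding symmetric_conv by metis
  then have "awalk (head G a) [b] u"
    using arc_implies_awalk by metis
  with q have "awalk v (q @ [b]) u" "length (q @ [b]) = length (a # p)"
    using awalk_appendI by auto
  then show ?case
    by blast
qed

lemma (in graph) bipartite_if_no_odd_cycle:
  assumes conn: "connected G"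
    and even: "\<And>c. undirected_cycle G c \<Longrightarrow> even (length c)"
  shows "bipartite G"
proof -
  \<comment> \<open>\<open>connected\<close> speaks of the symmetric closure of \<open>G\<close>; as
    \<open>G\<close> is symmetric, reachability in the closure is reachability in
    \<open>G\<close>.\<close>
  obtain r where "r \<in> verts G" and reach: "\<And>v. v \<in> verts G \<Longrightarrow> r \<rightarrow>\<^sup>*\<^bsub>G\<^esub> v"
    using conn reachable_mk_symmetric_eq[OF sym_arcs]
    by (fastforce simp: connected_def strongly_connected_def)
  define U where "U = {v. \<exists>p. awalk r p v \<and> even (length p)}"
  define V where "V = {v. \<exists>p. awalk r p v \<and> odd (length p)}"
  have "verts G = U \<union> V"
    using reach awalk_last_in_verts unfolding U_def V_def reachable_awalk by blast
  moreover have "U \<inter> V = {}"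
  proof (rule ccontr)
    assume "U \<inter> V \<noteq> {}"
    then obtain v p q where p: "awalk r p v" "even (length p)"
      and q: "awalk r q v" "odd (length q)"
      by (auto simp: U_def V_def)
    obtain q' where q': "awalk v q' r" "length q' = length q"
      using awalk_reverse[OF q(1)] by blast
    \<comment> \<open>Going out along the even walk and back along the odd one gives an odd closed
      walk.\<close>
    have "awalk r (p @ q') r" "odd (length (p @ q'))"
      using awalk_appendI[OF p(1) q'(1)] p q q' by auto
    then show False
      using odd_closed_awalk_imp_odd_undirected_cycle even by blast
  qed
  moreover have "(tail G e \<in> U \<and> head G e \<in> V) \<or> (tail G e \<in> V \<and> head G e \<in> U)"
    if e: "e \<in> arcs G" for e
  proof -
    obtain p where p: "awalk r p (tail G e)"
      using reach[OF tail_in_verts[OF e]] unfolding reachable_awalk by blast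
    have pe: "awalk r (p @ [e]) (head G e)"
      by (rule awalk_appendI[OF p arc_implies_awalk[OF e]])
    have "(even (length p) \<longrightarrow> head G e \<in> V) \<and> (odd (length p) \<longrightarrow> head G e \<in> U)"
      using pe unfolding U_def V_def
      by (intro conjI impI CollectI exI[of _ "p @ [e]"]) auto
    moreover have "(even (length p) \<longrightarrow> tail G e \<in> U) \<and> (odd (length p) \<longrightarrow> tail G e \<in> V)"
      using p unfolding U_def V_def by blast
    ultimately show ?thesis
      by blast
  qed
  ultimately show ?thesis
    unfolding bipartite_def by blast
qed

text \<open>Of the two opposite arcs of an edge, exactly one starts in \<open>U\<close>. Hence the
  arcs leaving \<open>U\<close> correspond one to one to the edges, and they can be counted by their
  tails.\<close>

lemma (in graph) card_edges_eq_sum_out_degree: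
  assumes verts: "verts G = U \<union> V" and disj: "U \<inter> V = {}"
    and arcs: "\<And>e. e \<in> arcs G \<Longrightarrow>
      (tail G e \<in> U \<and> head G e \<in> V) \<or> (tail G e \<in> V \<and> head G e \<in> U)"
  shows "card (edges G) = (\<Sum>u\<in>U. out_degree G u)"
proof -
  let ?A = "\<Union>u\<in>U. out_arcs G u" and ?ends = "\<lambda>e. {tail G e, head G e}"
  have inj: "inj_on ?ends ?A"
  proof (rule inj_onI)
    fix e f
    assume ef: "e \<in> ?A" "f \<in> ?A" "?ends e = ?ends f"
    have ends: "g \<in> arcs G \<and> tail G g \<in> U \<and> head G g \<in> V" if "g \<in> ?A" for g
    proof -
      have g: "g \<in> arcs G" "tail G g \<in> U"
        using that by simp_all
      with arcs[OF g(1)] disj show ?thesis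
        by blast
    qed
    \<comment> \<open>Two arcs with the same set of ends are parallel or opposite; the opposite case
      would put a vertex into both parts.\<close>
    have "tail G e \<noteq> head G f"
      using ends[OF ef(1)] ends[OF ef(2)] disj by (metis disjoint_iff)
    with ef(3) have "arc_to_ends G e = arc_to_ends G f"
      by (simp add: arc_to_ends_def doubleton_eq_iff)
    with ends[OF ef(1)] ends[OF ef(2)] show "e = f"
      by (intro no_multi_arcs) simp_all
  qed
  have image: "?ends ` ?A = edges G"
  proof
    show "?ends ` ?A \<subseteq> edges G"
      unfolding edges_def by (intro image_mono UN_least) (simp add: out_arcs_def)
    show "edges G \<subseteq> ?ends ` ?A"
    proof
      fix x
      assume "x \<in> edges G"
      then obtain e where e: "e \<in> arcs G" "x = ?ends e"
        by (auto simp: edges_def)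
      obtain f where f: "f \<in> arcs G" "tail G e = head G f" "head G e = tail G f"
        using e(1) sym_arcs unfolding symmetric_conv by blast
      \<comment> \<open>If \<open>e\<close> runs from \<open>V\<close> to \<open>U\<close>, its
        opposite arc \<open>f\<close> represents the same edge.\<close>
      have "e \<in> ?A \<or> f \<in> ?A"
        using arcs[OF e(1)] e(1) f by auto
      moreover have "x = ?ends f"
        using e(2) f(2,3) by (simp add: insert_commute)
      ultimately show "x \<in> ?ends ` ?A"
        using e(2) by blast
    qed
  qed
  have "card (edges G) = card ?A"
    using card_image[OF inj] unfolding image .
  also have "\<dots> = (\<Sum>u\<in>U. card (out_arcs G u))"
  proof (rule card_UN_disjoint)
    show "finite U"
      using finite_verts verts by simp
  qed auto
  finally show ?thesis
    by (simp add: out_degree_def)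
qed

theorem theorem10:
  fixes G :: "('a, 'b) pre_digraph" and p q :: nat
  assumes "G \<in> epsilon2"
    and "card (verts G) = p"
    and "card (edges G) = q"
  shows "bipartite G \<and> ([q = 0] (mod 4) \<or> [q = 2] (mod 4))"
proof -
  have "graph G" and conn: "connected G"
    and deg: "\<And>v. v \<in> verts G \<Longrightarrow> even (out_degree G v)"
    and len: "\<And>c. undirected_cycle G c \<Longrightarrow> [length c = 2] (mod 4)"
    using assms(1) by (auto simp: epsilon2_def euler_graph_def)
  interpret graph G by fact
  have bip: "bipartite G"
  proof (rule bipartite_if_no_odd_cycle[OF conn])
    show "even (length c)" if "undirected_cycle G c" for c
    proof -
      have "[length c = 2] (mod 2)"
        by (rule cong_dvd_modulus_nat[OF len[OF that]]) simp
      then show ?thesis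
        using cong_dvd_iff by force
    qed
  qed
  then obtain U V where UV: "verts G = U \<union> V" "U \<inter> V = {}"
    "\<forall>e \<in> arcs G. (tail G e \<in> U \<and> head G e \<in> V) \<or> (tail G e \<in> V \<and> head G e \<in> U)"
    unfolding bipartite_def by (elim exE conjE)
  have "q = (\<Sum>u\<in>U. out_degree G u)"
    using card_edges_eq_sum_out_degree[OF UV(1,2) bspec[OF UV(3)]] assms(3) by simp
  moreover have "even (\<Sum>u\<in>U. out_degree G u)"
    by (rule dvd_sum) (simp add: deg UV(1))
  ultimately obtain k where "q = 2 * k"
    by (auto elim: evenE)
  \<comment> \<open>The parity of \<open>k\<close> decides between the residues 0 and 2.\<close>
  then have "q mod 4 = 2 * (k mod 2)"
    using mult_mod_right[of 2 k 2] by simp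
  then have "[q = 0] (mod 4) \<or> [q = 2] (mod 4)"
    by (cases "even k") (simp_all add: cong_def even_iff_mod_2_eq_zero odd_iff_mod_2_eq_one)
  with bip show ?thesis
    by blast
qed

end
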